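(* Let $C^{ijkl}$ be an elasticity tensor in three dimensions, and let $M^{ijkl}:=C^{i(jk)l}$ and $N^{ijkl}:=C^{i[jk]l}$. Then both $M$ and $N$ have the major symmetry: $M^{ijkl}=M^{klij}$ and $N^{ijkl}=N^{klij}$ for all $i,j,k,l$.
   Context: Indices run over $1,2,3$. An elasticity tensor is a real fourth-rank tensor $C^{ijkl}$ on $\mathbb R^3$ with $C^{ijkl}=C^{jikl}$, $C^{ijkl}=C^{ijlk}$ (minor symmetries) and $C^{ijkl}=C^{klij}$ (major symmetry). Here $C^{i(jk)l}=\frac12(C^{ijkl}+C^{ikjl})$ and $C^{i[jk]l}=\frac12(C^{ijkl}-C^{ikjl})$. *)

theory Defs
  imports "HOL-Analysis.Finite_Cartesian_Product"
begin

text \<open>Components with respect to the standard basis: \<open>C $ i $ j $ k $ l\<close> is $C^{ijkl}$,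
  with indices in the three-element type \<open>3\<close>.\<close>

type_synonym tensor4 = "real ^ 3 ^ 3 ^ 3 ^ 3"

definition left_minor_symmetric :: "tensor4 \<Rightarrow> bool" where
  "left_minor_symmetric C \<longleftrightarrow> (\<forall>i j k l. C $ i $ j $ k $ l = C $ j $ i $ k $ l)"

definition right_minor_symmetric :: "tensor4 \<Rightarrow> bool" where
  "right_minor_symmetric C \<longleftrightarrow> (\<forall>i j k l. C $ i $ j $ k $ l = C $ i $ j $ l $ k)"

definition major_symmetric :: "tensor4 \<Rightarrow> bool" where
  "major_symmetric C \<longleftrightarrow> (\<forall>i j k l. C $ i $ j $ k $ l = C $ k $ l $ i $ j)"

definition elasticity_tensor :: "tensor4 \<Rightarrow> bool" where
  "elasticity_tensor C \<longleftrightarrow>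
     left_minor_symmetric C \<and> right_minor_symmetric C \<and> major_symmetric C"

text \<open>$C^{i(jk)l}$ and $C^{i[jk]l}$.\<close>

definition mid_sym :: "tensor4 \<Rightarrow> tensor4" where
  "mid_sym C = (\<chi> i j k l. (1/2) * (C $ i $ j $ k $ l + C $ i $ k $ j $ l))"

definition mid_antisym :: "tensor4 \<Rightarrow> tensor4" where
  "mid_antisym C = (\<chi> i j k l. (1/2) * (C $ i $ j $ k $ l - C $ i $ k $ j $ l))"

end

theory Submission
  imports Defs
begin

text \<open>Exchanging the pairs ij and kl sends C^{ijkl} to C^{klij}, equal to it by major
  symmetry, and C^{ikjl} to C^{kilj}, equal by the two minor symmetries combined. So each summand is
  invariant by itself, and hence so are their sum and difference.\<close>

theorem proposition2:
  fixes C M N :: tensor4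
  assumes "elasticity_tensor C"
    and "M = mid_sym C"
    and "N = mid_antisym C"
  shows "major_symmetric M \<and> major_symmetric N"
proof -
  have major: "C $ k $ l $ i $ j = C $ i $ j $ k $ l" for i j k l
    using assms(1) unfolding elasticity_tensor_def major_symmetric_def by blast
  have minor: "C $ k $ i $ l $ j = C $ i $ k $ j $ l" for i j k l
    using assms(1)
    unfolding elasticity_tensor_def left_minor_symmetric_def right_minor_symmetric_def by metis
  have "M $ i $ j $ k $ l = M $ k $ l $ i $ j" for i j k l
    \<comment> \<open>Instances at the fixed indices make each equation a one-way rewrite, taking
      the two terms of \<open>M $ k $ l $ i $ j\<close> to those of
      \<open>M $ i $ j $ k $ l\<close>.\<close>
    unfolding assms(2) mid_sym_def by (simp add: major[of k l i j] minor[of k i l j])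
  moreover have "N $ i $ j $ k $ l = N $ k $ l $ i $ j" for i j k l
    unfolding assms(3) mid_antisym_def by (simp add: major[of k l i j] minor[of k i l j])
  ultimately show ?thesis
    unfolding major_symmetric_def by blast
qed

end
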